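(* Let $0<\varepsilon<1$ and $0<\delta<1$ be a common precision and confidence level for the three reduced order models, i.e. $$\mathbb P[\mathcal E_R^{\text{POD-DL-ROM}}<\varepsilon]>1-\delta,\qquad\mathbb P_\nu[\mathcal E_R^{\text{DOD-DL-ROM}}<\varepsilon]>1-\delta,\qquad\mathbb P_\nu[\mathcal E_R^{\text{DOD+DFNN}}<\varepsilon]>1-\delta .$$ Let $N_h,n,s\in\mathbb N$ satisfy $$\frac n{s-1}>\frac{\log(N_h)}{\log(\varepsilon^{-1})},$$ let the parameter-to-solution map satisfy $\mathcal G\in W^{r,\infty}(\Theta\times\Theta'\times[0,T])$ with $r\in\mathbb N$, and let the optimal DOD map satisfy $s_*\in W^{m,\infty}(\Theta\times[0,T])$ with $m\in\mathbb N$ such that $$m\;\gtrsim\;\frac{p+1}{\frac n{s-1}-\log_\varepsilon\!\left(\frac{N-N'}{N_hN'}\right)} .$$ Then it is guaranteed that $$\omega_{\text{DOD+DFNN}}\lesssim\omega_{\text{DOD-DL-ROM}}\lesssim\omega_{\text{POD-DL-ROM}}\quad\text{if } r\ge\tfrac1n(s-1)(p+q+1),$$ and $$\omega_{\text{DOD-DL-ROM}}\lesssim\omega_{\text{POD-DL-ROM}}\quad\text{if } r\le\tfrac1n(s-1)(p+q+1).$$ If additionally the Kolmogorov widths satisfy $d_k(\mathcal S)\le Ck^{-\alpha}$ and $\sup_{(\mu,t)\in\Theta\times[0,T]}d_k(\mathcal S_{\mu,t})\le C'k^{-\beta}$ for all $k$, with constants $C,C'>0$, $0<\alpha<1$ and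 $\beta\ge1$, and $N_s,N_t\to\infty$, then the lower bound required on $m$ may be replaced by the sharper $$m\;\gtrsim\;\frac{p+1}{\frac n{s-1}-\frac{\log(N_h)}{\log(\varepsilon^{-1})}+\frac{\beta-\alpha}{\beta\alpha}} .$$
   Context: **Setting.** Let $p,q\in\mathbb N$, $\Theta\subset\mathbb R^p$ and $\Theta'\subset\mathbb R^q$ compact, $T>0$, and natural numbers $n<N'<N<N_A\le N_h$, with $N_A=N_h$. $\mathbb G\in\mathbb R^{N_h\times N_h}$ is symmetric positive definite, $\|u\|:=\sqrt{u^T\mathbb G u}$; $|\cdot|$ denotes the Euclidean norm of vectors and Lebesgue measure of sets. For $(\mu,\nu,t)\in\Theta\times\Theta'\times[0,T]$, $u^{\mu,\nu,t}\in\mathbb R^{N_h}$ is the coefficient vector at time $t$ of the solution of a spatially discretized parametric parabolic PDE, $\mathcal G:(\mu,\nu,t)\mapsto u^{\mu,\nu,t}$. $\mathcal S:=\{u^{\mu,\nu,t}\}$ is the total solution manifold, $\mathcal S_{\mu,t}:=\{u^{\mu,\nu,t}:\nu\in\Theta'\}$, and $d_k(\mathcal S):=\inf_{\mathbb V\in\mathbb R^{N_h\times k}}\sup_{u\in\mathcal S}\|u-\mathbb V\mathbb V^T\mathbb G u\|$. **Assumptions.** (i) $m_u:=\operatorname{ess\,inf}\|u^{\mu,\nu,t}\|>0$, $\operatorname{ess\,sup}\|u^{\mu,\nu,t}\|<\infty$, and $\mathcal G$ is Lipschitz. (ii) Training parameters are i.i.d. (uniformly distributed) samples, $N_{s_1}$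 in $\Theta$ and $N_{s_2}$ in $\Theta'$ (set $\mathcal P_2$), $N_s=N_{s_1}N_{s_2}\ge2$, times on the uniform grid with $N_t\ge2$ steps; $N_{\text{data}}=N_sN_t$. $\mathbb P$ is the probability over all samples, $\mathbb P_\nu$ over those in $\Theta'$. (iii) Perfect embedding: $n\le2(p+q)+3$, and for $K\in\{N,N'\}$ there are $C^s$ maps $\mathbb R^n\to\mathbb R^K$ and $C^{s'}$ maps $\mathbb R^K\to\mathbb R^n$ ($s\gg s'\ge2$, bounded derivatives) whose composition is the identity on the respective reduced solution manifold (POD coordinates for $N$, DOD coordinates for $N'$). (iv) The optimal DOD $s_*$ for $\mathcal P_2$ is Lipschitz, where $s_*(\mu,t)$ minimizes $\tilde{\mathbb V}\mapsto\frac{|\Theta'|}{N_{s_2}}\sum_{\nu\in\mathcal P_2}\|u^{\mu,\nu,t}-\mathbb A\tilde{\mathbb V}\tilde{\mathbb V}^T\mathbb A^T\mathbb G u^{\mu,\nu,t}\|^2$ over $[-1,1]^{N_A\times N'}$, with $\mathbb A\in\mathbb R^{N_h\times N_A}$ the ($\mathbb G$-orthonormal) POD matrix of the snapshots. **Models.** Networks are ReLU networks (realization $R_\rho$). POD-DL-ROM: $\hat u=\mathbb A_{\mathrm P}(\psi_N\circ\phi_n)(\mu,\nu,t)$ with $\mathbb A_{\mathrm P}\in\mathbb R^{N_h\times N}$ the POD matrix of dimension $N$, decoder network $\psi_N:\mathbb R^n\to\mathbb R^N$ and feed-forward network $\phi_n:\mathbb R^{p+q+1}\to\mathbb R^n$.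 DOD-DL-ROM: $\hat u=\mathbb V_{\mu,t}(\psi_{N'}\circ\phi_n)(\mu,\nu,t)$ with decoder $\psi_{N'}:\mathbb R^n\to\mathbb R^{N'}$. DOD+DFNN: $\hat u=\mathbb V_{\mu,t}\phi_{N'}(\mu,\nu,t)$ with feed-forward network $\phi_{N'}:\mathbb R^{p+q+1}\to\mathbb R^{N'}$. Here $\mathbb V_{\mu,t}=\mathbb A\tilde{\mathbb V}_{\mu,t}$ with $\tilde{\mathbb V}_{\mu,t}\in\mathbb R^{N_A\times N'}$ the column-orthonormalized output of a network in $(\mu,t)$ (inner DOD module). The relative error is $\mathcal E_R:=\Big(\int_{\Theta\times\Theta'\times[0,T]}\frac{\|u^{\mu,\nu,t}-\hat u^{\mu,\nu,t}\|^2}{\|u^{\mu,\nu,t}\|^2}d(\mu,\nu,t)\Big)^{1/2}$. **Dimensions.** $N$ is the smallest $k_0\in\mathbb N$ with $\sum_{k>k_0}\sigma_k^2\le\frac{m_u^2}9\varepsilon^2$, where $\sigma_1^2\ge\sigma_2^2\ge\cdots$ are the eigenvalues of $\frac{|\Theta\times\Theta'\times[0,T]|}{N_{\text{data}}}UU^T\mathbb G$, $U$ being the matrix of all snapshots. $N'$ is the smallest $k_0\in\mathbb N$ with $\sup_{(\mu,t)}\sum_{k>k_0}\sigma(\mu,t)_k^2\le\frac{m_u^2}{16|\Theta\times[0,T]|}\varepsilon^2$, where $\sigma(\mu,t)_k^2$ are the decreasingly ordered eigenvalues of $\frac{|\Theta'|}{N_{s_2}}\sum_{\nu\in\mathcal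 P_2}(\mathbb A^T\mathbb G u^{\mu,\nu,t})(\mathbb A^T\mathbb G u^{\mu,\nu,t})^T$. In the limit $N_s,N_t\to\infty$ under the width decay, these are taken to be of order $N=\mathcal O(\varepsilon^{-1/\alpha})$, $N'=\mathcal O(\varepsilon^{-1/\beta})$. **Compared quantities.** $\omega_{\text{model}}$ denotes the upper complexity bound (total number of active weights, i.e. nonzero network parameters, sufficient for precision $\varepsilon$), which up to multiplicative constants and a common factor $\log(\varepsilon^{-1})$ is $$\omega_{\text{POD-DL-ROM}}:\ N\varepsilon^{-n/(s-1)}+n\varepsilon^{-(p+q+1)/r},\qquad\omega_{\text{DOD-DL-ROM}}:\ N_hN'\varepsilon^{-(p+1)/m}+N'\varepsilon^{-n/(s-1)}+n\varepsilon^{-(p+q+1)/r},$$ $$\omega_{\text{DOD+DFNN}}:\ N_hN'\varepsilon^{-(p+1)/m}+N'\varepsilon^{-(p+q+1)/r}.$$ $a\lesssim b$ means $a\le\kappa b$ with a constant $\kappa$ independent of $\varepsilon$, $N$, $N'$, $N_h$; a requirement $m\gtrsim X$ means $m\ge\kappa X$ for a suitable sufficiently large constant $\kappa$.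
   Formalization: The denominator in each lower bound on m is assumed positive (otherwise the bound is void and the comparison can fail), and in the width-decay part N is assumed to be of order ε^{-1/α} from below as well as from above. *)

theory Defs
  imports
    "HOL-Analysis.Analysis"
    "HOL-Probability.Probability"
    "Jordan_Normal_Form.Char_Poly"
    "Jordan_Normal_Form.Gram_Schmidt"
begin

(* The dimensions n, N', N, N_h vary inside the statement, so vectors and matrices of these
   sizes are those of Jordan_Normal_Form; the parameter domains live in Euclidean types. *)

type_synonym rvec = "real Matrix.vec"
type_synonym rmat = "real Matrix.mat"

section \<open>Regularity of functions on Euclidean domains\<close>

fun iter_pderiv :: "'a::euclidean_space list \<Rightarrow> ('a \<Rightarrow> real) \<Rightarrow> 'a \<Rightarrow> real" where
  "iter_pderiv [] f = f"
| "iter_pderiv (b # bs) f = (\<lambda>x. frechet_derivative (iter_pderiv bs f) (at x) b)"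

definition test_function :: "'a::euclidean_space set \<Rightarrow> ('a \<Rightarrow> real) \<Rightarrow> bool" where
  "test_function \<Omega> \<phi> \<longleftrightarrow>
     (\<forall>bs. set bs \<subseteq> Basis \<longrightarrow> iter_pderiv bs \<phi> differentiable_on UNIV) \<and>
     compact (closure {x. \<phi> x \<noteq> 0}) \<and> closure {x. \<phi> x \<noteq> 0} \<subseteq> \<Omega>"

definition L_infty :: "'a::euclidean_space set \<Rightarrow> ('a \<Rightarrow> real) \<Rightarrow> bool" where
  "L_infty \<Omega> f \<longleftrightarrow> f \<in> borel_measurable (restrict_space lborel \<Omega>) \<and>
     (\<exists>B. AE x in restrict_space lborel \<Omega>. \<bar>f x\<bar> \<le> B)"

definition weak_deriv ::
  "'a::euclidean_space set \<Rightarrow> 'a list \<Rightarrow> ('a \<Rightarrow> real) \<Rightarrow> ('a \<Rightarrow> real) \<Rightarrow> bool" where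
  "weak_deriv \<Omega> bs f g \<longleftrightarrow> (\<forall>\<phi>. test_function \<Omega> \<phi> \<longrightarrow>
     (LINT x:\<Omega>|lborel. f x * iter_pderiv bs \<phi> x) =
     (-1) ^ length bs * (LINT x:\<Omega>|lborel. g x * \<phi> x))"

(* The Sobolev space of a compact domain D is taken on its interior. *)
definition W_infty :: "nat \<Rightarrow> 'a::euclidean_space set \<Rightarrow> ('a \<Rightarrow> real) set" where
  "W_infty k D = {f. L_infty (interior D) f \<and>
     (\<forall>bs. set bs \<subseteq> Basis \<and> length bs \<le> k \<longrightarrow>
        (\<exists>g. L_infty (interior D) g \<and> weak_deriv (interior D) bs f g))}"

section \<open>Maps between coordinate spaces of variable dimension\<close>

definition enorm :: "rvec \<Rightarrow> real" where
  "enorm v = sqrt (scalar_prod v v)"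

fun vec_pderiv :: "nat \<Rightarrow> nat list \<Rightarrow> (rvec \<Rightarrow> real) \<Rightarrow> rvec \<Rightarrow> real" where
  "vec_pderiv d [] f = f"
| "vec_pderiv d (i # js) f =
     (\<lambda>x. deriv (\<lambda>\<tau>. vec_pderiv d js f (x + \<tau> \<cdot>\<^sub>v unit_vec d i)) 0)"

definition vec_continuous :: "nat \<Rightarrow> (rvec \<Rightarrow> real) \<Rightarrow> bool" where
  "vec_continuous d f \<longleftrightarrow> (\<forall>x\<in>carrier_vec d. \<forall>e>0. \<exists>h>0. \<forall>y\<in>carrier_vec d.
     enorm (y - x) < h \<longrightarrow> \<bar>f y - f x\<bar> < e)"

(* C^k on R^d with bounded derivatives of the orders 1, ..., k *)
definition Ck_bounded :: "nat \<Rightarrow> nat \<Rightarrow> (rvec \<Rightarrow> real) \<Rightarrow> bool" where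
  "Ck_bounded d k f \<longleftrightarrow> (\<forall>js. set js \<subseteq> {..<d} \<and> length js \<le> k \<longrightarrow>
     vec_continuous d (vec_pderiv d js f) \<and>
     (js \<noteq> [] \<longrightarrow> (\<exists>B. \<forall>x\<in>carrier_vec d. \<bar>vec_pderiv d js f x\<bar> \<le> B)) \<and>
     (length js < k \<longrightarrow> (\<forall>i<d. \<forall>x\<in>carrier_vec d.
        (\<lambda>\<tau>. vec_pderiv d js f (x + \<tau> \<cdot>\<^sub>v unit_vec d i)) differentiable (at (0::real)))))"

definition Ck_map :: "nat \<Rightarrow> nat \<Rightarrow> nat \<Rightarrow> (rvec \<Rightarrow> rvec) \<Rightarrow> bool" where
  "Ck_map d k d' F \<longleftrightarrow> (\<forall>x\<in>carrier_vec d. F x \<in> carrier_vec d') \<and>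
     (\<forall>i<d'. Ck_bounded d k (\<lambda>x. vec_index (F x) i))"

definition perfect_embedding :: "nat \<Rightarrow> nat \<Rightarrow> nat \<Rightarrow> nat \<Rightarrow> rvec set \<Rightarrow> bool" where
  "perfect_embedding n K s s' M \<longleftrightarrow>
     (\<exists>\<Psi> \<Psi>'. Ck_map n s K \<Psi> \<and> Ck_map K s' n \<Psi>' \<and> (\<forall>c\<in>M. \<Psi> (\<Psi>' c) = c))"

section \<open>ReLU networks\<close>

type_synonym relu_net = "(rmat \<times> rvec) list"

fun realization :: "relu_net \<Rightarrow> rvec \<Rightarrow> rvec" where
  "realization [] x = x"
| "realization [(W, b)] x = W *\<^sub>v x + b"
| "realization ((W, b) # l # ls) x = realization (l # ls) (map_vec (max 0) (W *\<^sub>v x + b))"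

fun layers_fit :: "nat \<Rightarrow> relu_net \<Rightarrow> nat \<Rightarrow> bool" where
  "layers_fit a [] c \<longleftrightarrow> a = c"
| "layers_fit a ((W, b) # ls) c \<longleftrightarrow>
     W \<in> carrier_mat (dim_vec b) a \<and> layers_fit (dim_vec b) ls c"

definition is_net :: "nat \<Rightarrow> relu_net \<Rightarrow> nat \<Rightarrow> bool" where
  "is_net a \<Phi> c \<longleftrightarrow> \<Phi> \<noteq> [] \<and> layers_fit a \<Phi> c"

definition active_weights :: "relu_net \<Rightarrow> nat" where
  "active_weights \<Phi> = (\<Sum>(W, b) \<leftarrow> \<Phi>.
     card {(i, j). i < dim_row W \<and> j < dim_col W \<and> W $$ (i, j) \<noteq> 0} +
     card {i. i < dim_vec b \<and> vec_index b i \<noteq> 0})"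

(* Coordinates of a point of a Euclidean type as a network input, in some fixed order of the
   standard basis. *)
definition coords :: "'a::euclidean_space \<Rightarrow> rvec" where
  "coords y = Matrix.vec DIM('a) (\<lambda>i. inner y (from_nat_into Basis i))"

section \<open>Full-order problem\<close>

(* The parabolic PDE enters only through its semi-discrete solution map sol. *)
record ('a, 'b) problem =
  Par :: "'a set"
  Par' :: "'b set"
  Tend :: real
  fdim :: nat
  Gram :: rmat
  sol :: "'a \<times> 'b \<times> real \<Rightarrow> rvec"

definition gnorm :: "rmat \<Rightarrow> rvec \<Rightarrow> real" where
  "gnorm G v = sqrt (scalar_prod v (G *\<^sub>v v))"

definition param_dom :: "('a, 'b) problem \<Rightarrow> ('a \<times> 'b \<times> real) set" where
  "param_dom P = Par P \<times> Par' P \<times> {0..Tend P}"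

definition manifold :: "('a, 'b) problem \<Rightarrow> rvec set" where
  "manifold P = sol P ` param_dom P"

definition manifold_at :: "('a, 'b) problem \<Rightarrow> 'a \<Rightarrow> real \<Rightarrow> rvec set" where
  "manifold_at P \<mu> t = (\<lambda>\<nu>. sol P (\<mu>, \<nu>, t)) ` Par' P"

(* Essential infimum of the norm of the solution, as -esssup(-f). *)
definition m_u :: "('a::euclidean_space, 'b::euclidean_space) problem \<Rightarrow> real" where
  "m_u P = real_of_ereal (- esssup (restrict_space lborel (param_dom P))
     (\<lambda>y. - ereal (gnorm (Gram P) (sol P y))))"

definition kolmogorov_width :: "rmat \<Rightarrow> nat \<Rightarrow> rvec set \<Rightarrow> nat \<Rightarrow> ereal" where
  "kolmogorov_width G d M k = (INF V\<in>carrier_mat d k. SUP u\<in>M.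
     ereal (gnorm G (u - V *\<^sub>v (transpose_mat V *\<^sub>v (G *\<^sub>v u)))))"

locale full_order_problem =
  fixes P :: "('a::euclidean_space, 'b::euclidean_space) problem"
  assumes compact_par: "compact (Par P)" "compact (Par' P)"
    and time: "0 < Tend P"
    and gram_dim: "Gram P \<in> carrier_mat (fdim P) (fdim P)"
    and gram_sym: "transpose_mat (Gram P) = Gram P"
    and gram_pos: "\<And>v. v \<in> carrier_vec (fdim P) \<Longrightarrow> v \<noteq> 0\<^sub>v (fdim P) \<Longrightarrow>
                     0 < scalar_prod v (Gram P *\<^sub>v v)"
    and sol_dim: "\<And>y. y \<in> param_dom P \<Longrightarrow> sol P y \<in> carrier_vec (fdim P)"
    and ess_inf: "0 < m_u P"
    and ess_sup: "esssup (restrict_space lborel (param_dom P))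
                    (\<lambda>y. ereal (gnorm (Gram P) (sol P y))) < \<infinity>"
    and sol_lipschitz: "\<exists>L\<ge>0. \<forall>y\<in>param_dom P. \<forall>z\<in>param_dom P.
                          gnorm (Gram P) (sol P y - sol P z) \<le> L * dist y z"

section \<open>Sampling, POD and DOD\<close>

record sampling =
  Ns1 :: nat
  Ns2 :: nat
  Nt :: nat

type_synonym ('a, 'b) sample = "(nat \<Rightarrow> 'a) \<times> (nat \<Rightarrow> 'b)"

definition samples_mu :: "('a, 'b) problem \<Rightarrow> sampling \<Rightarrow> (nat \<Rightarrow> 'a) set" where
  "samples_mu P S = {..<Ns1 S} \<rightarrow>\<^sub>E Par P"

definition samples_nu :: "('a, 'b) problem \<Rightarrow> sampling \<Rightarrow> (nat \<Rightarrow> 'b) set" where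
  "samples_nu P S = {..<Ns2 S} \<rightarrow>\<^sub>E Par' P"

definition samples :: "('a, 'b) problem \<Rightarrow> sampling \<Rightarrow> ('a, 'b) sample set" where
  "samples P S = samples_mu P S \<times> samples_nu P S"

definition prob_mu :: "('a::euclidean_space, 'b) problem \<Rightarrow> sampling \<Rightarrow> (nat \<Rightarrow> 'a) measure" where
  "prob_mu P S = PiM {..<Ns1 S} (\<lambda>_. uniform_measure lborel (Par P))"

definition prob_nu :: "('a, 'b::euclidean_space) problem \<Rightarrow> sampling \<Rightarrow> (nat \<Rightarrow> 'b) measure" where
  "prob_nu P S = PiM {..<Ns2 S} (\<lambda>_. uniform_measure lborel (Par' P))"

definition prob_all ::
  "('a::euclidean_space, 'b::euclidean_space) problem \<Rightarrow> sampling \<Rightarrow> ('a, 'b) sample measure" where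
  "prob_all P S = prob_mu P S \<Otimes>\<^sub>M prob_nu P S"

(* Snapshot times are t_j = j T / N_t, j = 1, ..., N_t. *)
definition snapshots :: "('a, 'b) problem \<Rightarrow> sampling \<Rightarrow> ('a, 'b) sample \<Rightarrow> rmat" where
  "snapshots P S x = mat_of_cols (fdim P)
     [sol P (fst x i, snd x k, real j * Tend P / real (Nt S)).
        i \<leftarrow> [0..<Ns1 S], k \<leftarrow> [0..<Ns2 S], j \<leftarrow> [1..<Nt S + 1]]"

(* Real eigenvalues in decreasing order, repeated by algebraic multiplicity; the matrices
   concerned are similar to symmetric positive semidefinite ones. *)
definition eigvals_desc :: "rmat \<Rightarrow> real list" where
  "eigvals_desc M = rev (sorted_list_of_multiset (proots (char_poly M)))"

definition eig_tail :: "rmat \<Rightarrow> nat \<Rightarrow> real" where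
  "eig_tail M k0 = sum_list (drop k0 (eigvals_desc M))"

definition pod_correlation ::
  "('a::euclidean_space, 'b::euclidean_space) problem \<Rightarrow> sampling \<Rightarrow> ('a, 'b) sample \<Rightarrow> rmat" where
  "pod_correlation P S x =
     (measure lborel (param_dom P) / real (Ns1 S * Ns2 S * Nt S)) \<cdot>\<^sub>m
     (snapshots P S x * transpose_mat (snapshots P S x) * Gram P)"

definition pod_dim ::
  "('a::euclidean_space, 'b::euclidean_space) problem \<Rightarrow> sampling \<Rightarrow> real \<Rightarrow> ('a, 'b) sample \<Rightarrow> nat"
  where
  "pod_dim P S \<epsilon> x = (LEAST k0. eig_tail (pod_correlation P S x) k0 \<le> (m_u P)\<^sup>2 / 9 * \<epsilon>\<^sup>2)"

(* A POD matrix of dimension k: Gram-orthonormal eigenvectors of the k largest eigenvalues. *)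
definition pod_matrix ::
  "('a::euclidean_space, 'b::euclidean_space) problem \<Rightarrow> sampling \<Rightarrow> ('a, 'b) sample \<Rightarrow> nat \<Rightarrow>
   rmat \<Rightarrow> bool" where
  "pod_matrix P S x k A \<longleftrightarrow> A \<in> carrier_mat (fdim P) k \<and>
     transpose_mat A * Gram P * A = 1\<^sub>m k \<and>
     (\<forall>j<k. pod_correlation P S x *\<^sub>v col A j = (eigvals_desc (pod_correlation P S x) ! j) \<cdot>\<^sub>v col A j)"

definition ambient_coords :: "('a, 'b) problem \<Rightarrow> rmat \<Rightarrow> 'a \<times> 'b \<times> real \<Rightarrow> rvec" where
  "ambient_coords P A y = transpose_mat A *\<^sub>v (Gram P *\<^sub>v sol P y)"

definition dod_correlation ::
  "('a, 'b::euclidean_space) problem \<Rightarrow> sampling \<Rightarrow> ('a, 'b) sample \<Rightarrow> rmat \<Rightarrow> 'a \<Rightarrow> real \<Rightarrow> rmat"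
  where
  "dod_correlation P S x A \<mu> t = (measure lborel (Par' P) / real (Ns2 S)) \<cdot>\<^sub>m
     Matrix.mat (dim_col A) (dim_col A) (\<lambda>(i, j). \<Sum>k<Ns2 S.
        vec_index (ambient_coords P A (\<mu>, snd x k, t)) i *
        vec_index (ambient_coords P A (\<mu>, snd x k, t)) j)"

definition dod_dim ::
  "('a::euclidean_space, 'b::euclidean_space) problem \<Rightarrow> sampling \<Rightarrow> real \<Rightarrow> rmat \<Rightarrow>
   ('a, 'b) sample \<Rightarrow> nat" where
  "dod_dim P S \<epsilon> A x = (LEAST k0.
     (SUP (\<mu>, t)\<in>Par P \<times> {0..Tend P}. ereal (eig_tail (dod_correlation P S x A \<mu> t) k0))
       \<le> ereal ((m_u P)\<^sup>2 / (16 * measure lborel (Par P \<times> {0..Tend P})) * \<epsilon>\<^sup>2))"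

definition dod_objective ::
  "('a, 'b::euclidean_space) problem \<Rightarrow> sampling \<Rightarrow> ('a, 'b) sample \<Rightarrow> rmat \<Rightarrow> 'a \<times> real \<Rightarrow>
   rmat \<Rightarrow> real" where
  "dod_objective P S x A = (\<lambda>(\<mu>, t) V. measure lborel (Par' P) / real (Ns2 S) *
     (\<Sum>k<Ns2 S. (gnorm (Gram P) (sol P (\<mu>, snd x k, t) -
        A *\<^sub>v (V *\<^sub>v (transpose_mat V *\<^sub>v ambient_coords P A (\<mu>, snd x k, t)))))\<^sup>2))"

definition dod_candidates :: "nat \<Rightarrow> nat \<Rightarrow> rmat set" where
  "dod_candidates a b = {V \<in> carrier_mat a b. \<forall>i<a. \<forall>j<b. V $$ (i, j) \<in> {-1..1}}"

definition optimal_dod ::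
  "('a, 'b::euclidean_space) problem \<Rightarrow> sampling \<Rightarrow> ('a, 'b) sample \<Rightarrow> rmat \<Rightarrow> nat \<Rightarrow>
   ('a \<times> real \<Rightarrow> rmat) \<Rightarrow> bool" where
  "optimal_dod P S x A N' s_opt \<longleftrightarrow> (\<forall>z\<in>Par P \<times> {0..Tend P}.
     s_opt z \<in> dod_candidates (dim_col A) N' \<and>
     (\<forall>V\<in>dod_candidates (dim_col A) N'.
        dod_objective P S x A z (s_opt z) \<le> dod_objective P S x A z V))"

section \<open>The reduced order models\<close>

definition rel_error ::
  "('a::euclidean_space, 'b::euclidean_space) problem \<Rightarrow> ('a \<times> 'b \<times> real \<Rightarrow> rvec) \<Rightarrow> real" where
  "rel_error P uhat = sqrt (LINT y:param_dom P|lborel.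
     (gnorm (Gram P) (sol P y - uhat y))\<^sup>2 / (gnorm (Gram P) (sol P y))\<^sup>2)"

definition orthonormalize :: "rmat \<Rightarrow> rmat" where
  "orthonormalize W = mat_of_cols (dim_row W)
     (map (\<lambda>v. (1 / enorm v) \<cdot>\<^sub>v v) (gram_schmidt (dim_row W) (cols W)))"

(* The network output of length a * b is read column by column as an a x b matrix. *)
definition inner_dod :: "nat \<Rightarrow> nat \<Rightarrow> relu_net \<Rightarrow> 'a::euclidean_space \<times> real \<Rightarrow> rmat" where
  "inner_dod a b \<Phi> z = orthonormalize (Matrix.mat a b
     (\<lambda>(i, j). vec_index (realization \<Phi> (coords z)) (j * a + i)))"

definition POD_DL_ROM ::
  "rmat \<Rightarrow> relu_net \<Rightarrow> relu_net \<Rightarrow> 'a::euclidean_space \<times> 'b::euclidean_space \<times> real \<Rightarrow> rvec" where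
  "POD_DL_ROM AP \<psi> \<phi> y = AP *\<^sub>v realization \<psi> (realization \<phi> (coords y))"

definition DOD_DL_ROM ::
  "rmat \<Rightarrow> nat \<Rightarrow> relu_net \<Rightarrow> relu_net \<Rightarrow> relu_net \<Rightarrow>
   'a::euclidean_space \<times> 'b::euclidean_space \<times> real \<Rightarrow> rvec" where
  "DOD_DL_ROM A N' \<Phi> \<psi> \<phi> = (\<lambda>(\<mu>, \<nu>, t).
     (A * inner_dod (dim_col A) N' \<Phi> (\<mu>, t)) *\<^sub>v
     realization \<psi> (realization \<phi> (coords (\<mu>, \<nu>, t))))"

definition DOD_DFNN ::
  "rmat \<Rightarrow> nat \<Rightarrow> relu_net \<Rightarrow> relu_net \<Rightarrow>
   'a::euclidean_space \<times> 'b::euclidean_space \<times> real \<Rightarrow> rvec" where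
  "DOD_DFNN A N' \<Phi> \<phi> = (\<lambda>(\<mu>, \<nu>, t).
     (A * inner_dod (dim_col A) N' \<Phi> (\<mu>, t)) *\<^sub>v realization \<phi> (coords (\<mu>, \<nu>, t)))"

(* Bases, networks and complexity bounds of the three models, all depending on the random
   training sample. *)
record ('a, 'b) rom_family =
  pod_basis :: "('a, 'b) sample \<Rightarrow> rmat"
  pod_decoder :: "('a, 'b) sample \<Rightarrow> relu_net"
  pod_ff :: "('a, 'b) sample \<Rightarrow> relu_net"
  ambient :: "('a, 'b) sample \<Rightarrow> rmat"
  dl_inner :: "('a, 'b) sample \<Rightarrow> relu_net"
  dl_decoder :: "('a, 'b) sample \<Rightarrow> relu_net"
  dl_ff :: "('a, 'b) sample \<Rightarrow> relu_net"
  df_inner :: "('a, 'b) sample \<Rightarrow> relu_net"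
  df_ff :: "('a, 'b) sample \<Rightarrow> relu_net"
  \<omega>_POD_DL_ROM :: "('a, 'b) sample \<Rightarrow> real"
  \<omega>_DOD_DL_ROM :: "('a, 'b) sample \<Rightarrow> real"
  \<omega>_DOD_DFNN :: "('a, 'b) sample \<Rightarrow> real"

definition rate_POD_DL_ROM :: "nat \<Rightarrow> nat \<Rightarrow> nat \<Rightarrow> nat \<Rightarrow> nat \<Rightarrow> nat \<Rightarrow> real \<Rightarrow> real" where
  "rate_POD_DL_ROM p q n s r N \<epsilon> =
     real N * \<epsilon> powr (- (real n / (real s - 1)))
     + real n * \<epsilon> powr (- (real (p + q + 1) / real r))"

definition rate_DOD_DL_ROM ::
  "nat \<Rightarrow> nat \<Rightarrow> nat \<Rightarrow> nat \<Rightarrow> nat \<Rightarrow> nat \<Rightarrow> nat \<Rightarrow> nat \<Rightarrow> real \<Rightarrow> real" where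
  "rate_DOD_DL_ROM p q n s r m Nh N' \<epsilon> =
     real Nh * real N' * \<epsilon> powr (- (real (p + 1) / real m))
     + real N' * \<epsilon> powr (- (real n / (real s - 1)))
     + real n * \<epsilon> powr (- (real (p + q + 1) / real r))"

definition rate_DOD_DFNN ::
  "nat \<Rightarrow> nat \<Rightarrow> nat \<Rightarrow> nat \<Rightarrow> nat \<Rightarrow> nat \<Rightarrow> real \<Rightarrow> real" where
  "rate_DOD_DFNN p q r m Nh N' \<epsilon> =
     real Nh * real N' * \<epsilon> powr (- (real (p + 1) / real m))
     + real N' * \<epsilon> powr (- (real (p + q + 1) / real r))"

definition of_order :: "real \<Rightarrow> real \<Rightarrow> real \<Rightarrow> real \<Rightarrow> real \<Rightarrow> bool" where
  "of_order c1 c2 \<epsilon> \<omega> rate \<longleftrightarrow>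
     c1 * (rate * ln (1 / \<epsilon>)) \<le> \<omega> \<and> \<omega> \<le> c2 * (rate * ln (1 / \<epsilon>))"

(* Precision is asked of the networks counted by the complexity bounds, whose hidden constants
   are c1 and c2.  x is the realized training sample, N and N' its POD and DOD dimensions; the
   DOD precisions are conditional on the mu-samples of x.  The DOD coordinates in the perfect
   embedding are those of the optimal DOD. *)
locale rom_comparison = full_order_problem P
  for P :: "('a::euclidean_space, 'b::euclidean_space) problem" +
  fixes c1 c2 \<epsilon> \<delta> :: real
    and n s s' r m NA :: nat
    and S :: sampling
    and R :: "('a, 'b) rom_family"
    and x :: "('a, 'b) sample"
    and s_opt :: "'a \<times> real \<Rightarrow> rmat"
    and N N' :: nat
  assumes eps: "0 < \<epsilon>" "\<epsilon> < 1"
    and delta: "0 < \<delta>" "\<delta> < 1"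
    and sampling_size: "2 \<le> Ns1 S * Ns2 S" "2 \<le> Nt S"
    and sample: "x \<in> samples P S"
    and N_eq: "N = pod_dim P S \<epsilon> x"
    and N'_eq: "N' = dod_dim P S \<epsilon> (ambient R x) x"
    and dims: "n < N'" "N' < N" "N < NA" "NA \<le> fdim P" "NA = fdim P"
    and pod: "\<And>z. z \<in> samples P S \<Longrightarrow> pod_matrix P S z (pod_dim P S \<epsilon> z) (pod_basis R z)"
    and ambient: "\<And>z. z \<in> samples P S \<Longrightarrow> pod_matrix P S z NA (ambient R z)"
    and embedding_dim: "n \<le> 2 * (DIM('a) + DIM('b)) + 3"
    and embedding_smooth: "2 \<le> s'" "s' < s"
    and embedding_POD: "perfect_embedding n N s s'
          (ambient_coords P (pod_basis R x) ` param_dom P)"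
    and embedding_DOD: "perfect_embedding n N' s s'
          ((\<lambda>(\<mu>, \<nu>, t). transpose_mat (s_opt (\<mu>, t)) *\<^sub>v ambient_coords P (ambient R x) (\<mu>, \<nu>, t)) ` param_dom P)"
    and dod_optimal: "optimal_dod P S x (ambient R x) N' s_opt"
    and dod_lipschitz: "\<exists>L. \<forall>y\<in>Par P \<times> {0..Tend P}. \<forall>z\<in>Par P \<times> {0..Tend P}. \<forall>i<NA. \<forall>j<N'.
          \<bar>s_opt y $$ (i, j) - s_opt z $$ (i, j)\<bar> \<le> L * dist y z"
    and orders: "1 \<le> r" "1 \<le> m"
    and sol_regular: "\<And>i. i < fdim P \<Longrightarrow> (\<lambda>y. vec_index (sol P y) i) \<in> W_infty r (param_dom P)"
    and dod_regular: "\<And>i j. i < NA \<Longrightarrow> j < N' \<Longrightarrow>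
          (\<lambda>z. s_opt z $$ (i, j)) \<in> W_infty m (Par P \<times> {0..Tend P})"
    and POD_DL_ROM_nets: "\<And>z. z \<in> samples P S \<Longrightarrow>
          is_net n (pod_decoder R z) (pod_dim P S \<epsilon> z) \<and>
          is_net (DIM('a) + DIM('b) + 1) (pod_ff R z) n \<and>
          real (active_weights (pod_decoder R z) + active_weights (pod_ff R z)) \<le> \<omega>_POD_DL_ROM R z"
    and DOD_DL_ROM_nets: "\<And>z. z \<in> samples P S \<Longrightarrow>
          is_net (DIM('a) + 1) (dl_inner R z) (NA * dod_dim P S \<epsilon> (ambient R z) z) \<and>
          is_net n (dl_decoder R z) (dod_dim P S \<epsilon> (ambient R z) z) \<and>
          is_net (DIM('a) + DIM('b) + 1) (dl_ff R z) n \<and>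
          real (active_weights (dl_inner R z) + active_weights (dl_decoder R z)
                + active_weights (dl_ff R z)) \<le> \<omega>_DOD_DL_ROM R z"
    and DOD_DFNN_nets: "\<And>z. z \<in> samples P S \<Longrightarrow>
          is_net (DIM('a) + 1) (df_inner R z) (NA * dod_dim P S \<epsilon> (ambient R z) z) \<and>
          is_net (DIM('a) + DIM('b) + 1) (df_ff R z) (dod_dim P S \<epsilon> (ambient R z) z) \<and>
          real (active_weights (df_inner R z) + active_weights (df_ff R z)) \<le> \<omega>_DOD_DFNN R z"
    and POD_DL_ROM_precision: "measure (prob_all P S) {z \<in> samples P S.
          rel_error P (POD_DL_ROM (pod_basis R z) (pod_decoder R z) (pod_ff R z)) < \<epsilon>} > 1 - \<delta>"
    and DOD_DL_ROM_precision: "measure (prob_nu P S) {\<nu>s \<in> samples_nu P S.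
          let z = (fst x, \<nu>s) in rel_error P (DOD_DL_ROM (ambient R z)
            (dod_dim P S \<epsilon> (ambient R z) z) (dl_inner R z) (dl_decoder R z) (dl_ff R z)) < \<epsilon>} > 1 - \<delta>"
    and DOD_DFNN_precision: "measure (prob_nu P S) {\<nu>s \<in> samples_nu P S.
          let z = (fst x, \<nu>s) in rel_error P (DOD_DFNN (ambient R z)
            (dod_dim P S \<epsilon> (ambient R z) z) (df_inner R z) (df_ff R z)) < \<epsilon>} > 1 - \<delta>"
    and POD_DL_ROM_order: "\<And>z. z \<in> samples P S \<Longrightarrow> of_order c1 c2 \<epsilon> (\<omega>_POD_DL_ROM R z)
          (rate_POD_DL_ROM DIM('a) DIM('b) n s r (pod_dim P S \<epsilon> z) \<epsilon>)"
    and DOD_DL_ROM_order: "\<And>z. z \<in> samples P S \<Longrightarrow> of_order c1 c2 \<epsilon> (\<omega>_DOD_DL_ROM R z)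
          (rate_DOD_DL_ROM DIM('a) DIM('b) n s r m (fdim P) (dod_dim P S \<epsilon> (ambient R z) z) \<epsilon>)"
    and DOD_DFNN_order: "\<And>z. z \<in> samples P S \<Longrightarrow> of_order c1 c2 \<epsilon> (\<omega>_DOD_DFNN R z)
          (rate_DOD_DFNN DIM('a) DIM('b) r m (fdim P) (dod_dim P S \<epsilon> (ambient R z) z) \<epsilon>)"

(* m >~ (p + 1) / D with constant K.  A lower bound of this form presupposes D > 0; for D <= 0
   it would be void, and the comparison is then false in general. *)
definition smooth_enough :: "real \<Rightarrow> nat \<Rightarrow> nat \<Rightarrow> real \<Rightarrow> bool" where
  "smooth_enough K m p D \<longleftrightarrow> 0 < D \<and> real m \<ge> K * (real (p + 1) / D)"

end

theory Submission
  imports Defs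
begin

text \<open>
  Write \<open>E = 1 / \<epsilon> > 1\<close>, \<open>a = n / (s - 1)\<close> and \<open>b = (p + 1) / m\<close>.  Passing from the POD-DL-ROM to the
  DOD-DL-ROM shrinks the decoder cost from \<open>N E^a\<close> to \<open>N' E^a\<close> and adds the cost \<open>N\<^sub>h N' E^b\<close> of the inner
  DOD module, while the feed-forward cost stays the same.  So the DOD-DL-ROM is no more expensive
  as soon as the inner module fits into the saving, \<open>N\<^sub>h N' E^b \<le> (N - N') E^a\<close>.  Taking
  logarithms to base \<open>E\<close>, this reads \<open>b \<le> a - log\<^sub>\<epsilon> ((N - N') / (N\<^sub>h N'))\<close>, which is precisely the
  smoothness requirement on \<open>m\<close> with constant 1 (\<open>inner_cost_le_saving\<close>).

  Under the width decay, \<open>N\<close> is of order \<open>E powr (1 / \<alpha>)\<close> and \<open>N'\<close> at most of order \<open>E powr (1 / \<beta>)\<close>, so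
  \<open>N / (N\<^sub>h N')\<close> is at least of order \<open>E powr ((\<beta> - \<alpha>) / (\<beta> \<alpha>)) / N\<^sub>h\<close>.  The sharper requirement on \<open>m\<close>
  then bounds the inner cost by \<open>a2 / a1\<close> times the POD decoder cost \<open>N E^a\<close>
  (\<open>inner_cost_le_POD_decoder\<close>), so that the rates compare up to the constant \<open>1 + a2 / a1\<close>.

  Finally, the DOD-DL-ROM and the DOD+DFNN share the inner module.  Besides it, with
  \<open>c = (p + q + 1) / r\<close>, the former pays \<open>N' E^a + n E^c\<close> and the latter \<open>N' E^c\<close>, which is no more if
  \<open>c \<le> a\<close>; this is the lower bound on \<open>r\<close>.
  Comparisons of rates pass to the complexity bounds at the price of the factor \<open>c2 / c1\<close>.
\<close>

section \<open>The cost of the inner DOD module\<close>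

text \<open>
  With constant 1, the requirement on \<open>m\<close> says that the approximation exponent \<open>(p + 1) / m\<close> of the
  inner DOD module is at most the denominator \<open>D\<close>.
\<close>

lemma powr_le_if_smooth_enough:
  assumes "smooth_enough 1 m p D" "0 < \<epsilon>" "\<epsilon> < 1"
  shows "\<epsilon> powr (- (real (p + 1) / real m)) \<le> \<epsilon> powr (- D)"
proof -
  have D: "0 < D" and m: "real (p + 1) / D \<le> real m"
    using assms(1) by (simp_all add: smooth_enough_def)
  have "0 < real (p + 1) / D" using D by simp
  with m have "0 < real m" by linarith
  then have "real (p + 1) / real m \<le> D"
    using D m by (simp add: field_simps)
  then show ?thesis using assms(2,3) by (simp add: powr_mono')
qed

lemma inner_cost_le_saving:
  fixes Nh N N' a \<epsilon> :: real
  assumes smooth: "smooth_enough 1 m p (a - log \<epsilon> ((N - N') / (Nh * N')))"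
    and eps: "0 < \<epsilon>" "\<epsilon> < 1" and pos: "0 < Nh" "0 < N'" "N' < N"
  shows "Nh * N' * \<epsilon> powr (- (real (p + 1) / real m)) \<le> (N - N') * \<epsilon> powr (- a)"
proof -
  let ?y = "(N - N') / (Nh * N')"
  have y: "0 < ?y" using pos by simp
  have "Nh * N' * \<epsilon> powr (- (real (p + 1) / real m)) \<le> Nh * N' * \<epsilon> powr (- (a - log \<epsilon> ?y))"
    using pos by (intro mult_left_mono powr_le_if_smooth_enough[OF smooth eps]) auto
  also have "\<epsilon> powr (- (a - log \<epsilon> ?y)) = \<epsilon> powr (- a) * \<epsilon> powr (log \<epsilon> ?y)"
    by (simp flip: powr_add)
  also have "\<epsilon> powr (log \<epsilon> ?y) = ?y"
    using eps y by (intro powr_log_cancel) auto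
  also have "Nh * N' * (\<epsilon> powr (- a) * ?y) = (N - N') * \<epsilon> powr (- a)"
    using pos by simp
  finally show ?thesis .
qed

lemma inner_cost_le_POD_decoder:
  fixes Nh N N' a \<alpha> \<beta> \<epsilon> a1 a2 :: real
  assumes smooth: "smooth_enough 1 m p (a - ln Nh / ln (1 / \<epsilon>) + (\<beta> - \<alpha>) / (\<beta> * \<alpha>))"
    and eps: "0 < \<epsilon>" "\<epsilon> < 1" and pos: "0 < Nh" "0 < N'" "0 < \<alpha>" "0 < \<beta>" "0 < a1" "0 < a2"
    and N: "a1 * \<epsilon> powr (- (1 / \<alpha>)) \<le> N" and N': "N' \<le> a2 * \<epsilon> powr (- (1 / \<beta>))"
  shows "Nh * N' * \<epsilon> powr (- (real (p + 1) / real m)) \<le> a2 / a1 * (N * \<epsilon> powr (- a))"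
proof -
  let ?D = "a - ln Nh / ln (1 / \<epsilon>) + (\<beta> - \<alpha>) / (\<beta> * \<alpha>)"
  have Nh: "Nh * \<epsilon> powr (ln Nh / ln (1 / \<epsilon>)) = 1"
    using eps pos by (simp add: powr_def ln_div exp_minus)
  \<comment> \<open>\<open>(\<beta> - \<alpha>) / (\<beta> * \<alpha>)\<close> is \<open>1 / \<alpha> - 1 / \<beta>\<close>: its second part absorbs \<open>N'\<close>, its first part is paid by \<open>N\<close>.\<close>
  have D: "- ?D = ln Nh / ln (1 / \<epsilon>) + (1 / \<beta> + (- (1 / \<alpha>) + - a))"
    using pos by (simp add: field_simps)
  have "Nh * N' * \<epsilon> powr (- (real (p + 1) / real m)) \<le> Nh * N' * \<epsilon> powr (- ?D)"
    using pos by (intro mult_left_mono powr_le_if_smooth_enough[OF smooth eps]) auto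
  also have "\<dots> = (Nh * \<epsilon> powr (ln Nh / ln (1 / \<epsilon>)))
      * (N' * (\<epsilon> powr (1 / \<beta>) * (\<epsilon> powr (- (1 / \<alpha>)) * \<epsilon> powr (- a))))"
    unfolding D powr_add by (simp only: mult_ac)
  also have "\<dots> = N' * (\<epsilon> powr (1 / \<beta>) * (\<epsilon> powr (- (1 / \<alpha>)) * \<epsilon> powr (- a)))"
    by (simp only: Nh mult_1_left)
  also have "\<dots> \<le> (a2 * \<epsilon> powr (- (1 / \<beta>))) * (\<epsilon> powr (1 / \<beta>) * (\<epsilon> powr (- (1 / \<alpha>)) * \<epsilon> powr (- a)))"
    using N' by (intro mult_right_mono) auto
  also have "\<dots> = a2 * (\<epsilon> powr (- (1 / \<beta>)) * \<epsilon> powr (1 / \<beta>)) * (\<epsilon> powr (- (1 / \<alpha>)) * \<epsilon> powr (- a))"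
    by (simp only: mult_ac)
  also have "\<dots> = a2 / a1 * ((a1 * \<epsilon> powr (- (1 / \<alpha>))) * \<epsilon> powr (- a))"
    using eps pos by (simp flip: powr_add)
  also have "\<dots> \<le> a2 / a1 * (N * \<epsilon> powr (- a))"
    using N pos by (intro mult_left_mono mult_right_mono) auto
  finally show ?thesis .
qed

section \<open>Comparison of the three models\<close>

lemma of_order_mono:
  assumes A: "of_order c1 c2 \<epsilon> \<omega>A A" and B: "of_order c1 c2 \<epsilon> \<omega>B B"
    and le: "A \<le> M * B" and c: "0 < c1" "0 < c2" and eps: "0 < \<epsilon>" "\<epsilon> < 1" and M: "0 \<le> M"
  shows "\<omega>A \<le> c2 / c1 * M * \<omega>B"
proof -
  have L: "0 < ln (1 / \<epsilon>)" using eps by simp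
  have "\<omega>A \<le> c2 * (A * ln (1 / \<epsilon>))" using A by (simp add: of_order_def)
  also have "\<dots> \<le> c2 * (M * B * ln (1 / \<epsilon>))"
    using le L c by (intro mult_left_mono mult_right_mono) auto
  also have "\<dots> = c2 / c1 * M * (c1 * (B * ln (1 / \<epsilon>)))" using c by simp
  also have "\<dots> \<le> c2 / c1 * M * \<omega>B"
    using B c M by (intro mult_left_mono) (auto simp: of_order_def)
  finally show ?thesis .
qed

context rom_comparison
begin

lemma dims_pos: "0 < real (fdim P)" "0 < real N'" "real N' < real N" "1 < real (fdim P)"
  using dims by auto

text \<open>
  The feed-forward costs of the two models coincide, so only the inner module and the decoder have
  to be paid for by the decoder of the POD-DL-ROM.
\<close>

lemma DOD_DL_ROM_le_POD_DL_ROM: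
  assumes c: "0 < c1" "0 < c2" and M: "1 \<le> M"
    and inner: "real (fdim P) * real N' * \<epsilon> powr (- (real (DIM('a) + 1) / real m))
          + real N' * \<epsilon> powr (- (real n / (real s - 1)))
        \<le> M * (real N * \<epsilon> powr (- (real n / (real s - 1))))"
  shows "\<omega>_DOD_DL_ROM R x \<le> c2 / c1 * M * \<omega>_POD_DL_ROM R x"
proof (rule of_order_mono)
  show "of_order c1 c2 \<epsilon> (\<omega>_DOD_DL_ROM R x)
      (rate_DOD_DL_ROM DIM('a) DIM('b) n s r m (fdim P) N' \<epsilon>)"
    using DOD_DL_ROM_order[OF sample] by (simp add: N'_eq)
  show "of_order c1 c2 \<epsilon> (\<omega>_POD_DL_ROM R x) (rate_POD_DL_ROM DIM('a) DIM('b) n s r N \<epsilon>)"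
    using POD_DL_ROM_order[OF sample] by (simp add: N_eq)
  let ?F = "real n * \<epsilon> powr (- (real (DIM('a) + DIM('b) + 1) / real r))"
  have "1 * ?F \<le> M * ?F" using M by (intro mult_right_mono) auto
  then show "rate_DOD_DL_ROM DIM('a) DIM('b) n s r m (fdim P) N' \<epsilon>
      \<le> M * rate_POD_DL_ROM DIM('a) DIM('b) n s r N \<epsilon>"
    using inner unfolding rate_DOD_DL_ROM_def rate_POD_DL_ROM_def distrib_left by linarith
qed (use c M eps in auto)

text \<open>
  As \<open>N\<^sub>h > 1\<close>, the lower bound on \<open>n / (s - 1)\<close> forces \<open>n > 0\<close>.  This makes the threshold on \<open>r\<close> meaningful:
  for \<open>n = 0\<close> the factor \<open>1 / n\<close> would take the default value 0.
\<close>

lemma DOD_DFNN_le_DOD_DL_ROM: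
  assumes c: "0 < c1" "0 < c2"
    and slope: "real n / (real s - 1) > ln (real (fdim P)) / ln (1 / \<epsilon>)"
    and r: "real r \<ge> 1 / real n * (real s - 1) * real (DIM('a) + DIM('b) + 1)"
  shows "\<omega>_DOD_DFNN R x \<le> c2 / c1 * 1 * \<omega>_DOD_DL_ROM R x"
proof (rule of_order_mono)
  show "of_order c1 c2 \<epsilon> (\<omega>_DOD_DL_ROM R x)
      (rate_DOD_DL_ROM DIM('a) DIM('b) n s r m (fdim P) N' \<epsilon>)"
    using DOD_DL_ROM_order[OF sample] by (simp add: N'_eq)
  show "of_order c1 c2 \<epsilon> (\<omega>_DOD_DFNN R x) (rate_DOD_DFNN DIM('a) DIM('b) r m (fdim P) N' \<epsilon>)"
    using DOD_DFNN_order[OF sample] by (simp add: N'_eq)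
  have s: "0 < real s - 1" using embedding_smooth by simp
  have "0 < ln (real (fdim P)) / ln (1 / \<epsilon>)"
    using eps dims_pos by (intro divide_pos_pos ln_gt_zero) auto
  with slope have "0 < real n / (real s - 1)" by linarith
  with s have n: "0 < real n" by (simp add: zero_less_divide_iff)
  have "real (DIM('a) + DIM('b) + 1) / real r \<le> real n / (real s - 1)"
    using r n s orders by (simp add: field_simps)
  then have "\<epsilon> powr (- (real (DIM('a) + DIM('b) + 1) / real r)) \<le> \<epsilon> powr (- (real n / (real s - 1)))"
    using eps by (intro powr_mono') auto
  then have "real N' * \<epsilon> powr (- (real (DIM('a) + DIM('b) + 1) / real r))
      \<le> real N' * \<epsilon> powr (- (real n / (real s - 1)))"
    by (intro mult_left_mono) auto
  then show "rate_DOD_DFNN DIM('a) DIM('b) r m (fdim P) N' \<epsilon>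
      \<le> 1 * rate_DOD_DL_ROM DIM('a) DIM('b) n s r m (fdim P) N' \<epsilon>"
    unfolding rate_DOD_DFNN_def rate_DOD_DL_ROM_def by (simp add: add_increasing2)
qed (use c eps in auto)

lemma \<omega>_nonneg: "0 \<le> \<omega>_DOD_DL_ROM R x" "0 \<le> \<omega>_POD_DL_ROM R x"
  using DOD_DL_ROM_nets[OF sample] POD_DL_ROM_nets[OF sample]
  by (auto intro: order_trans[OF of_nat_0_le_iff])

end

theorem proposition7:
  fixes c1 c2 a1 a2 :: real
  assumes "0 < c1" "0 < c2" "0 < a1" "0 < a2"
  shows "\<exists>K>0. \<exists>\<kappa>>0.
    (\<forall>(P :: (real^'p, real^'q) problem) \<epsilon> \<delta> n s s' r m NA S R x s_opt N N'.
       rom_comparison P c1 c2 \<epsilon> \<delta> n s s' r m NA S R x s_opt N N' \<and>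
       real n / (real s - 1) > ln (real (fdim P)) / ln (1 / \<epsilon>) \<and>
       smooth_enough K m CARD('p) (real n / (real s - 1)
         - log \<epsilon> ((real N - real N') / (real (fdim P) * real N')))
       \<longrightarrow>
       (real r \<ge> 1 / real n * (real s - 1) * real (CARD('p) + CARD('q) + 1) \<longrightarrow>
          \<omega>_DOD_DFNN R x \<le> \<kappa> * \<omega>_DOD_DL_ROM R x \<and>
          \<omega>_DOD_DL_ROM R x \<le> \<kappa> * \<omega>_POD_DL_ROM R x) \<and>
       (real r \<le> 1 / real n * (real s - 1) * real (CARD('p) + CARD('q) + 1) \<longrightarrow>
          \<omega>_DOD_DL_ROM R x \<le> \<kappa> * \<omega>_POD_DL_ROM R x)) \<and>
    (\<forall>(P :: (real^'p, real^'q) problem) \<epsilon> \<delta> n s s' r m NA S R x s_opt N N' C C' \<alpha> \<beta>.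
       (\<forall>k::nat. rom_comparison P c1 c2 \<epsilon> \<delta> n s s' r m NA
          (S k) (R k) (x k) (s_opt k) (N k) (N' k)) \<and>
       real n / (real s - 1) > ln (real (fdim P)) / ln (1 / \<epsilon>) \<and>
       0 < C \<and> 0 < C' \<and> 0 < \<alpha> \<and> \<alpha> < 1 \<and> 1 \<le> \<beta> \<and>
       (\<forall>k\<ge>1. kolmogorov_width (Gram P) (fdim P) (manifold P) k \<le> ereal (C * real k powr (- \<alpha>))) \<and>
       (\<forall>k\<ge>1. (SUP (\<mu>, t)\<in>Par P \<times> {0..Tend P}.
            kolmogorov_width (Gram P) (fdim P) (manifold_at P \<mu> t) k)
          \<le> ereal (C' * real k powr (- \<beta>))) \<and>
       filterlim (\<lambda>k. Ns1 (S k) * Ns2 (S k)) at_top sequentially \<and>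
       filterlim (\<lambda>k. Nt (S k)) at_top sequentially \<and>
       (\<forall>\<^sub>F k in sequentially.
          a1 * \<epsilon> powr (- (1 / \<alpha>)) \<le> real (N k) \<and> real (N k) \<le> a2 * \<epsilon> powr (- (1 / \<alpha>)) \<and>
          real (N' k) \<le> a2 * \<epsilon> powr (- (1 / \<beta>))) \<and>
       smooth_enough K m CARD('p) (real n / (real s - 1)
         - ln (real (fdim P)) / ln (1 / \<epsilon>) + (\<beta> - \<alpha>) / (\<beta> * \<alpha>))
       \<longrightarrow>
       (\<forall>\<^sub>F k in sequentially.
         (real r \<ge> 1 / real n * (real s - 1) * real (CARD('p) + CARD('q) + 1) \<longrightarrow>
            \<omega>_DOD_DFNN (R k) (x k) \<le> \<kappa> * \<omega>_DOD_DL_ROM (R k) (x k) \<and>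
            \<omega>_DOD_DL_ROM (R k) (x k) \<le> \<kappa> * \<omega>_POD_DL_ROM (R k) (x k)) \<and>
         (real r \<le> 1 / real n * (real s - 1) * real (CARD('p) + CARD('q) + 1) \<longrightarrow>
            \<omega>_DOD_DL_ROM (R k) (x k) \<le> \<kappa> * \<omega>_POD_DL_ROM (R k) (x k))))"
proof -
  let ?M = "1 + a2 / a1"
  let ?\<kappa> = "c2 / c1 * ?M"
  have M: "1 \<le> ?M" and \<kappa>: "0 < ?\<kappa>" and \<kappa>1: "c2 / c1 * 1 \<le> ?\<kappa>"
    using assms by (simp_all add: add_pos_pos field_simps)
  have DFNN: "\<omega>_DOD_DFNN R x \<le> ?\<kappa> * \<omega>_DOD_DL_ROM R x"
    if "rom_comparison P c1 c2 \<epsilon> \<delta> n s s' r m NA S R x s_opt N N'"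
      and "real n / (real s - 1) > ln (real (fdim P)) / ln (1 / \<epsilon>)"
      and "real r \<ge> 1 / real n * (real s - 1) * real (CARD('p) + CARD('q) + 1)"
    for P :: "(real^'p, real^'q) problem" and \<epsilon> \<delta> n s s' r m NA S R x s_opt N N'
  proof -
    interpret rom_comparison P c1 c2 \<epsilon> \<delta> n s s' r m NA S R x s_opt N N' by (fact that(1))
    have "\<omega>_DOD_DFNN R x \<le> c2 / c1 * 1 * \<omega>_DOD_DL_ROM R x"
      using that(2,3) assms by (intro DOD_DFNN_le_DOD_DL_ROM) simp_all
    also have "\<dots> \<le> ?\<kappa> * \<omega>_DOD_DL_ROM R x"
      by (intro mult_right_mono \<kappa>1 \<omega>_nonneg)
    finally show ?thesis .
  qed
  have DOD: "\<omega>_DOD_DL_ROM R x \<le> ?\<kappa> * \<omega>_POD_DL_ROM R x"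
    if "rom_comparison P c1 c2 \<epsilon> \<delta> n s s' r m NA S R x s_opt N N'"
      and "smooth_enough 1 m CARD('p) (real n / (real s - 1)
         - log \<epsilon> ((real N - real N') / (real (fdim P) * real N')))"
    for P :: "(real^'p, real^'q) problem" and \<epsilon> \<delta> n s s' r m NA S R x s_opt N N'
  proof -
    interpret rom_comparison P c1 c2 \<epsilon> \<delta> n s s' r m NA S R x s_opt N N' by (fact that(1))
    have "\<omega>_DOD_DL_ROM R x \<le> c2 / c1 * 1 * \<omega>_POD_DL_ROM R x"
      using inner_cost_le_saving[OF that(2) eps dims_pos(1-3)] assms
      by (intro DOD_DL_ROM_le_POD_DL_ROM) (simp_all add: left_diff_distrib)
    also have "\<dots> \<le> ?\<kappa> * \<omega>_POD_DL_ROM R x"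
      by (intro mult_right_mono \<kappa>1 \<omega>_nonneg)
    finally show ?thesis .
  qed
  have DOD_decay: "\<omega>_DOD_DL_ROM R x \<le> ?\<kappa> * \<omega>_POD_DL_ROM R x"
    if "rom_comparison P c1 c2 \<epsilon> \<delta> n s s' r m NA S R x s_opt N N'"
      and smooth: "smooth_enough 1 m CARD('p) (real n / (real s - 1)
         - ln (real (fdim P)) / ln (1 / \<epsilon>) + (\<beta> - \<alpha>) / (\<beta> * \<alpha>))"
      and exps: "0 < \<alpha>" "0 < \<beta>"
      and N: "a1 * \<epsilon> powr (- (1 / \<alpha>)) \<le> real N" and N': "real N' \<le> a2 * \<epsilon> powr (- (1 / \<beta>))"
    for P :: "(real^'p, real^'q) problem" and \<epsilon> \<delta> n s s' r m NA S R x s_opt N N' \<alpha> \<beta>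
  proof -
    interpret rom_comparison P c1 c2 \<epsilon> \<delta> n s s' r m NA S R x s_opt N N' by (fact that(1))
    have "real N' * \<epsilon> powr (- (real n / (real s - 1))) \<le> real N * \<epsilon> powr (- (real n / (real s - 1)))"
      using dims_pos by (intro mult_right_mono) auto
    with inner_cost_le_POD_decoder[OF smooth eps dims_pos(1,2) exps assms(3,4) N N']
    show ?thesis
      using assms M by (intro DOD_DL_ROM_le_POD_DL_ROM) (simp_all add: distrib_right)
  qed
  show ?thesis
  proof (rule exI[of _ "1 :: real"], rule conjI, simp,
      rule exI[of _ ?\<kappa>], rule conjI[OF \<kappa>], rule conjI; intro allI impI; elim conjE)
    fix P :: "(real^'p, real^'q) problem" and \<epsilon> \<delta> n s s' r m NA S R x s_opt N N'
    assume rom: "rom_comparison P c1 c2 \<epsilon> \<delta> n s s' r m NA S R x s_opt N N'"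
      and slope: "ln (real (fdim P)) / ln (1 / \<epsilon>) < real n / (real s - 1)"
      and smooth: "smooth_enough 1 m CARD('p) (real n / (real s - 1)
         - log \<epsilon> ((real N - real N') / (real (fdim P) * real N')))"
    show "(real r \<ge> 1 / real n * (real s - 1) * real (CARD('p) + CARD('q) + 1) \<longrightarrow>
          \<omega>_DOD_DFNN R x \<le> ?\<kappa> * \<omega>_DOD_DL_ROM R x \<and>
          \<omega>_DOD_DL_ROM R x \<le> ?\<kappa> * \<omega>_POD_DL_ROM R x) \<and>
       (real r \<le> 1 / real n * (real s - 1) * real (CARD('p) + CARD('q) + 1) \<longrightarrow>
          \<omega>_DOD_DL_ROM R x \<le> ?\<kappa> * \<omega>_POD_DL_ROM R x)"
      using DFNN[OF rom slope] DOD[OF rom smooth] by blast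
  next
    fix P :: "(real^'p, real^'q) problem"
      and \<epsilon> \<delta> n s s' r m NA S R x s_opt N N' and C C' \<alpha> \<beta> :: real
    assume rom: "\<forall>k::nat. rom_comparison P c1 c2 \<epsilon> \<delta> n s s' r m NA
          (S k) (R k) (x k) (s_opt k) (N k) (N' k)"
      and slope: "ln (real (fdim P)) / ln (1 / \<epsilon>) < real n / (real s - 1)"
      and \<alpha>: "0 < \<alpha>" and "1 \<le> \<beta>"
      and orders: "\<forall>\<^sub>F k in sequentially.
          a1 * \<epsilon> powr (- (1 / \<alpha>)) \<le> real (N k) \<and> real (N k) \<le> a2 * \<epsilon> powr (- (1 / \<alpha>)) \<and>
          real (N' k) \<le> a2 * \<epsilon> powr (- (1 / \<beta>))"
      and smooth: "smooth_enough 1 m CARD('p) (real n / (real s - 1)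
         - ln (real (fdim P)) / ln (1 / \<epsilon>) + (\<beta> - \<alpha>) / (\<beta> * \<alpha>))"
    from \<open>1 \<le> \<beta>\<close> have \<beta>: "0 < \<beta>" by simp
    show "\<forall>\<^sub>F k in sequentially.
         (real r \<ge> 1 / real n * (real s - 1) * real (CARD('p) + CARD('q) + 1) \<longrightarrow>
            \<omega>_DOD_DFNN (R k) (x k) \<le> ?\<kappa> * \<omega>_DOD_DL_ROM (R k) (x k) \<and>
            \<omega>_DOD_DL_ROM (R k) (x k) \<le> ?\<kappa> * \<omega>_POD_DL_ROM (R k) (x k)) \<and>
         (real r \<le> 1 / real n * (real s - 1) * real (CARD('p) + CARD('q) + 1) \<longrightarrow>
            \<omega>_DOD_DL_ROM (R k) (x k) \<le> ?\<kappa> * \<omega>_POD_DL_ROM (R k) (x k))"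
      using orders
    proof (rule eventually_mono)
      fix k
      assume "a1 * \<epsilon> powr (- (1 / \<alpha>)) \<le> real (N k) \<and> real (N k) \<le> a2 * \<epsilon> powr (- (1 / \<alpha>)) \<and>
          real (N' k) \<le> a2 * \<epsilon> powr (- (1 / \<beta>))"
      then have "\<omega>_DOD_DL_ROM (R k) (x k) \<le> ?\<kappa> * \<omega>_POD_DL_ROM (R k) (x k)"
        using DOD_decay[OF rom[rule_format] smooth \<alpha> \<beta>] by blast
      then show "(real r \<ge> 1 / real n * (real s - 1) * real (CARD('p) + CARD('q) + 1) \<longrightarrow>
            \<omega>_DOD_DFNN (R k) (x k) \<le> ?\<kappa> * \<omega>_DOD_DL_ROM (R k) (x k) \<and>
            \<omega>_DOD_DL_ROM (R k) (x k) \<le> ?\<kappa> * \<omega>_POD_DL_ROM (R k) (x k)) \<and>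
         (real r \<le> 1 / real n * (real s - 1) * real (CARD('p) + CARD('q) + 1) \<longrightarrow>
            \<omega>_DOD_DL_ROM (R k) (x k) \<le> ?\<kappa> * \<omega>_POD_DL_ROM (R k) (x k))"
        using DFNN[OF rom[rule_format] slope] by blast
    qed
  qed
qed

end
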